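(* For every $n \geq 0$, the number of Dyck paths of semilength $n$ which have no up-run of length $3$ or more equals the $n$th Motzkin number $M_n$.
   Context: A Dyck path is a finite (possibly empty) word in the letters $U$ (standing for $+1$) and $D$ (standing for $-1$) whose partial sums are all nonnegative and whose total sum is $0$. A Dyck path of length $2n$ is said to have semilength $n$. An up-run of length $\ell$ is a block of $\ell$ consecutive $U$'s that is neither preceded nor followed by a $U$ (a maximal block of $U$'s). A Motzkin path is a finite word in the letters $U$ ($+1$), $D$ ($-1$) and $S$ ($0$, a sideways step not changing the height) whose partial sums are all nonnegative and whose total sum is $0$. The $n$th Motzkin number $M_n$ is the number of Motzkin paths of length $n$ (that is, with $n$ letters); its generating function $M(z) = \sum_{n\ge 0} M_n z^n$ satisfies $M = 1 + zM + z^2M^2$. *)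

theory Defs
  imports Main
begin

datatype step = U | D | S

fun rise :: "step \<Rightarrow> int" where
  "rise U = 1"
| "rise D = - 1"
| "rise S = 0"

definition height :: "step list \<Rightarrow> int" where
  "height w = sum_list (map rise w)"

definition motzkin_path :: "step list \<Rightarrow> bool" where
  "motzkin_path w \<longleftrightarrow> (\<forall>k\<le>length w. 0 \<le> height (take k w)) \<and> height w = 0"

definition dyck_path :: "step list \<Rightarrow> bool" where
  "dyck_path w \<longleftrightarrow>
     set w \<subseteq> {U, D} \<and> (\<forall>k\<le>length w. 0 \<le> height (take k w)) \<and> height w = 0"

definition dyck_paths_of_semilength :: "nat \<Rightarrow> step list set" where
  "dyck_paths_of_semilength n = {w. dyck_path w \<and> length w = 2 * n}"

definition has_up_run :: "nat \<Rightarrow> step list \<Rightarrow> bool" where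
  "has_up_run l w \<longleftrightarrow> 1 \<le> l \<and>
     (\<exists>xs ys. w = xs @ replicate l U @ ys \<and>
        (xs = [] \<or> last xs \<noteq> U) \<and> (ys = [] \<or> hd ys \<noteq> U))"

definition motzkin_number :: "nat \<Rightarrow> nat" where
  "motzkin_number n = card {w. motzkin_path w \<and> length w = n}"

(* Both counts below are of finite sets, so card is the honest number of elements. *)

lemma finite_step_lists: "finite {w :: step list. length w = n}"
proof -
  have "(UNIV :: step set) = {U, D, S}"
    by (auto intro: step.exhaust)
  then have "finite (UNIV :: step set)"
    by (metis finite.emptyI finite.insertI)
  from finite_lists_length_eq[OF this, of n] show ?thesis by simp
qed

lemma finite_dyck_paths_of_semilength: "finite (dyck_paths_of_semilength n)"
  unfolding dyck_paths_of_semilength_def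
  by (rule finite_subset[OF _ finite_step_lists[of "2 * n"]]) auto

lemma finite_motzkin_paths: "finite {w. motzkin_path w \<and> length w = n}"
  by (rule finite_subset[OF _ finite_step_lists[of n]]) auto

end

theory Submission
  imports Defs "HOL-Library.Sublist"
begin

text \<open>
  A nonempty Dyck path ends in \<open>D\<close>, so cutting it after each \<open>D\<close> writes it as a product of blocks
  \<open>U\<^sup>a D\<close>, one for each of its \<open>n\<close> letters \<open>D\<close>. Having no up-run of length 3 or more means that
  each \<open>a\<close> is 0, 1 or 2. The block then contributes \<open>a - 1\<close> to the height, as does the Motzkin
  step \<open>D\<close>, \<open>S\<close> or \<open>U\<close> respectively, and within a block the height is never below the smaller of
  its values at the two ends. Replacing blocks by steps is therefore a bijection onto Motzkin paths
  of length \<open>n\<close>.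
\<close>

fun block :: "step \<Rightarrow> step list" where
  "block U = [U, U, D]"
| "block S = [U, D]"
| "block D = [D]"

definition expand :: "step list \<Rightarrow> step list" where
  "expand m = concat (map block m)"

lemma expand_simps [simp]:
  "expand [] = []"
  "expand (x # m) = block x @ expand m"
  by (simp_all add: expand_def)

text \<open>Carrying the current height along lets inductions remove letters or whole blocks from
  the front. The starting height itself is not tested, so later lemmas assume
  \<open>0 \<le> h\<close>.\<close>

fun path_from :: "int \<Rightarrow> step list \<Rightarrow> bool" where
  "path_from h [] \<longleftrightarrow> h = 0"
| "path_from h (x # w) \<longleftrightarrow> 0 \<le> h + rise x \<and> path_from (h + rise x) w"

lemma height_simps [simp]:
  "height [] = 0"
  "height (x # w) = rise x + height w"
  by (simp_all add: height_def)

lemma all_le_Suc_iff: "(\<forall>k\<le>Suc n. P k) \<longleftrightarrow> P 0 \<and> (\<forall>k\<le>n. P (Suc k))"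
  by (auto simp: less_Suc_eq_0_disj simp flip: less_Suc_eq_le)

lemma path_from_iff:
  assumes "0 \<le> h"
  shows "path_from h w \<longleftrightarrow> (\<forall>k\<le>length w. 0 \<le> h + height (take k w)) \<and> h + height w = 0"
  using assms
proof (induction w arbitrary: h)
  case (Cons x w)
  show ?case
  proof (cases "0 \<le> h + rise x")
    case True
    then show ?thesis
      using Cons by (simp add: all_le_Suc_iff add.assoc)
  next
    case False
    then have "\<not> (\<forall>k\<le>length (x # w). 0 \<le> h + height (take k (x # w)))"
      \<comment> \<open>The prefix \<open>[x]\<close> already ends below the axis.\<close>
      by (auto intro!: exI[of _ 1])
    then show ?thesis using False by simp
  qed
qed simp

lemma motzkin_path_iff: "motzkin_path w \<longleftrightarrow> path_from 0 w"
  by (simp add: motzkin_path_def path_from_iff)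

lemma dyck_path_iff: "dyck_path w \<longleftrightarrow> set w \<subseteq> {U, D} \<and> path_from 0 w"
  by (simp add: dyck_path_def path_from_iff)

lemma path_from_expand: "0 \<le> h \<Longrightarrow> path_from h (expand m) \<longleftrightarrow> path_from h m"
proof (induction m arbitrary: h)
  case (Cons x m)
  then show ?case by (cases x) (auto simp: add.commute)
qed simp

lemma set_expand: "set (expand m) \<subseteq> {U, D}"
proof (induction m)
  case (Cons x m)
  then show ?case by (cases x) auto
qed simp

text \<open>Each \<open>block x\<close> has length \<open>2 + rise x\<close>. On a path ending at
  height 0 the corrections cancel, so semilength corresponds to the number of Motzkin steps.\<close>

lemma length_expand: "int (length (expand m)) = 2 * int (length m) + height m"
proof (induction m)
  case (Cons x m)
  then show ?case by (cases x) auto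
qed simp

text \<open>The blocks form a prefix code: \<open>D\<close> occurs in a block only as its last
  letter, so the first \<open>D\<close> of a word marks the end of its first block.\<close>

lemma inj_expand: "inj expand"
proof (rule injI)
  fix m m'
  assume "expand m = expand m'"
  then show "m = m'"
  proof (induction m arbitrary: m')
    case Nil
    then show ?case
      by (cases m') (auto elim: block.elims)
  next
    case (Cons x m)
    obtain y m'' where m': "m' = y # m''"
      using Cons.prems by (cases m'; cases x) auto
    with Cons show ?case
      by (cases x; cases y) auto
  qed
qed

text \<open>A factor of \<open>n\<close> letters \<open>U\<close> extends to a maximal run, and a
  longer run contains such a factor. Avoiding a factor, unlike a condition on maximal runs, passes
  directly to suffixes.\<close>

lemma has_long_up_run_iff:
  assumes "1 \<le> n"
  shows "(\<exists>l\<ge>n. has_up_run l w) \<longleftrightarrow> sublist (replicate n U) w"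
proof
  assume "\<exists>l\<ge>n. has_up_run l w"
  then obtain l xs ys where "n \<le> l" "w = xs @ replicate l U @ ys"
    unfolding has_up_run_def by auto
  then have "w = xs @ replicate n U @ (replicate (l - n) U @ ys)"
    by (metis append.assoc le_add_diff_inverse replicate_add)
  then show "sublist (replicate n U) w"
    unfolding sublist_def by blast
next
  assume "sublist (replicate n U) w"
  then obtain xs ys where w: "w = xs @ replicate n U @ ys"
    unfolding sublist_def by blast
  \<comment> \<open>\<open>a\<close> and \<open>b\<close> count the letters \<open>U\<close>
    adjacent to the chosen factor on the left and on the right; absorbing them makes the run
    maximal.\<close>
  define a where "a = length (takeWhile (\<lambda>x. x = U) (rev xs))"
  define b where "b = length (takeWhile (\<lambda>x. x = U) ys)"
  define xs' where "xs' = rev (dropWhile (\<lambda>x. x = U) (rev xs))"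
  define ys' where "ys' = dropWhile (\<lambda>x. x = U) ys"
  have run: "takeWhile (\<lambda>x. x = U) zs = replicate (length (takeWhile (\<lambda>x. x = U) zs)) U" for zs
    by (induction zs) auto
  have ys: "ys = replicate b U @ ys'"
    unfolding b_def ys'_def by (metis run takeWhile_dropWhile_id)
  have "rev xs = replicate a U @ rev xs'"
    unfolding a_def xs'_def rev_rev_ident by (metis run takeWhile_dropWhile_id)
  then have xs: "xs = xs' @ replicate a U"
    by (metis rev_append rev_replicate rev_rev_ident)
  have "w = xs' @ replicate (a + n + b) U @ ys'"
    unfolding w xs ys by (simp add: replicate_add)
  moreover have "xs' = [] \<or> last xs' \<noteq> U"
    using hd_dropWhile[of "\<lambda>x. x = U" "rev xs"] unfolding xs'_def by (auto simp: last_rev)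
  moreover have "ys' = [] \<or> hd ys' \<noteq> U"
    using hd_dropWhile[of "\<lambda>x. x = U" ys] unfolding ys'_def by auto
  ultimately have "has_up_run (a + n + b) w"
    using assms unfolding has_up_run_def by auto
  then show "\<exists>l\<ge>n. has_up_run l w"
    by (meson le_add1 le_add2 le_trans)
qed

text \<open>Each block has at most two letters \<open>U\<close> and ends in \<open>D\<close>, so a
  factor of \<open>U\<close>'s cannot cross from one block into the next.\<close>

lemma not_sublist_UUU_expand: "\<not> sublist [U, U, U] (expand m)"
proof (induction m)
  case (Cons x m)
  then show ?case by (cases x) (auto simp: sublist_Cons_right)
qed simp

text \<open>Blocks are cut off from the left. The height \<open>h\<close> is arbitrary because the
  rest of the word starts where the removed block ends, and the induction is on length because a
  block has up to three letters.\<close>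

lemma expand_surj:
  assumes "0 \<le> h" "path_from h w" "set w \<subseteq> {U, D}" "\<not> sublist [U, U, U] w"
  shows "\<exists>m. w = expand m"
  using assms
proof (induction w arbitrary: h rule: length_induct)
  case (1 w)
  have IH: "\<exists>m. v = expand m"
    if "length v < length w" "sublist v w" "0 \<le> h'" "path_from h' v" for v h'
  proof -
    have "set v \<subseteq> {U, D}"
      using set_mono_sublist[OF that(2)] "1.prems"(3) by blast
    moreover have "\<not> sublist [U, U, U] v"
      using that(2) "1.prems"(4) sublist_order.order_trans by blast
    ultimately show ?thesis
      using "1.IH" that by blast
  qed
  consider "w = []" | v where "w = D # v" | v where "w = U # D # v" | v where "w = U # U # D # v"
    | "w = [U]" | "w = [U, U]" | v where "w = U # U # U # v"
    using "1.prems"(3)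
    by (cases w; cases "tl w"; cases "tl (tl w)") auto
  then show ?case
  proof cases
    case 1
    then show ?thesis by (intro exI[of _ "[]"]) simp
  next
    case (2 v)
    then obtain m where "v = expand m"
      using IH[of v "h - 1"] "1.prems" by (auto simp: sublist_Cons_right)
    with 2 show ?thesis by (intro exI[of _ "D # m"]) simp
  next
    case (3 v)
    then obtain m where "v = expand m"
      using IH[of v h] "1.prems" by (auto simp: sublist_Cons_right)
    with 3 show ?thesis by (intro exI[of _ "S # m"]) simp
  next
    case (4 v)
    then obtain m where "v = expand m"
      using IH[of v "1 + h"] "1.prems" by (auto simp: sublist_Cons_right)
    with 4 show ?thesis by (intro exI[of _ "U # m"]) simp
  \<comment> \<open>The remaining cases are impossible: \<open>[U]\<close> and \<open>[U, U]\<close>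
    end at the positive heights \<open>h + 1\<close> and \<open>h + 2\<close>, and the last word
    begins with the forbidden factor.\<close>
  qed (use "1.prems" in \<open>auto simp: sublist_Cons_right\<close>)
qed

theorem proposition5:
  fixes n :: nat
  shows "card {w \<in> dyck_paths_of_semilength n. \<not> (\<exists>l\<ge>3. has_up_run l w)} = motzkin_number n"
proof -
  have height_0: "height m = 0" if "path_from 0 m" for m
    using that by (simp add: path_from_iff)
  have no_run: "\<not> (\<exists>l\<ge>3. has_up_run l w) \<longleftrightarrow> \<not> sublist [U, U, U] w" for w
    using has_long_up_run_iff[of 3 w] by (simp add: numeral_3_eq_3)
  have "{w \<in> dyck_paths_of_semilength n. \<not> (\<exists>l\<ge>3. has_up_run l w)}
      = expand ` {m. motzkin_path m \<and> length m = n}" (is "?A = expand ` ?B")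
  proof
    show "?A \<subseteq> expand ` ?B"
    proof
      fix w
      assume "w \<in> ?A"
      then have w: "set w \<subseteq> {U, D}" "path_from 0 w" "length w = 2 * n" "\<not> sublist [U, U, U] w"
        unfolding dyck_paths_of_semilength_def dyck_path_iff no_run by blast+
      then obtain m where m: "w = expand m"
        using expand_surj[of 0 w] by auto
      with w have "path_from 0 m" by (simp add: path_from_expand)
      moreover from this have "length m = n"
        using length_expand[of m] height_0[of m] w(3) m by simp
      ultimately show "w \<in> expand ` ?B"
        using m by (simp add: motzkin_path_iff)
    qed
  next
    show "expand ` ?B \<subseteq> ?A"
    proof (rule image_subsetI)
      fix m
      assume "m \<in> ?B"
      then have m: "path_from 0 m" "length m = n"
        by (simp_all add: motzkin_path_iff)
      then have "length (expand m) = 2 * n"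
        using length_expand[of m] height_0[of m] by simp
      with m show "expand m \<in> ?A"
        using set_expand[of m]
        by (simp only: mem_Collect_eq dyck_paths_of_semilength_def dyck_path_iff no_run
            path_from_expand not_sublist_UUU_expand order_refl not_False_eq_True simp_thms)
    qed
  qed
  then show ?thesis
    unfolding motzkin_number_def
    by (simp only: card_image[OF inj_on_subset[OF inj_expand subset_UNIV]])
qed

end
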